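(* Let $\varphi$ be a Ma-Minda function with $\varphi(z)=1+B_1z+B_2z^2+B_3z^3+\cdots$, and let $f\in\mathcal{C}(\varphi)$. Put $$\sigma_4=\frac{4B_2-7B_1^2}{2B_1},\qquad \mu_4=\frac{6B_1^3-7B_1B_2+2B_3}{2B_1}.$$ If $(\sigma_4,\mu_4)\in\Omega_1\cup\Omega_2\cup\Omega_3$ and $B_1\le|2B_1^2-B_2|$, then $$|b_3^2-b_4^2|\le\frac{(B_2-2B_1^2)^2}{36}+\frac{(6B_1^3-7B_1B_2+2B_3)^2}{576}.$$ The estimate is sharp (for each such $\varphi$, equality is attained by some $f\in\mathcal{C}(\varphi)$).
   Context: $\mathbb{U}=\{z\in\mathbb{C}:|z|<1\}$, and $\mathcal{A}$ is the class of analytic functions $f$ on $\mathbb{U}$ of the form $f(z)=z+\sum_{n\ge2}a_nz^n$. For analytic $g,h$ on $\mathbb{U}$, $g\prec h$ (subordination) means there is an analytic $\omega:\mathbb{U}\to\mathbb{C}$ with $\omega(0)=0$, $|\omega(z)|\le1$, and $g=h\circ\omega$. A Ma-Minda function is an analytic univalent $\varphi$ on $\mathbb{U}$ with $\varphi(0)=1$, $\varphi'(0)>0$, mapping $\mathbb{U}$ onto a domain in the right half-plane that is symmetric about the real axis and starlike with respect to $\varphi(0)=1$ (so $B_1>0$ and all $B_n$ are real). $\mathcal{C}(\varphi)=\{f\in\mathcal{A}: 1+zf''(z)/f'(z)\prec\varphi(z)\}$; its members are univalent. The local inverse near $0$ is written $f^{-1}(w)=w+\sum_{n\ge2}b_nw^n$;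 thus $b_3=-a_3+2a_2^2$, $b_4=-5a_2^3+5a_2a_3-a_4$. Regions in $\mathbb{R}^2$: $\Omega_1=\{(\sigma,\mu):|\sigma|\le2,\ \mu\ge1\}$, $\Omega_2=\{(\sigma,\mu):2\le|\sigma|\le4,\ \mu\ge\frac1{12}(\sigma^2+8)\}$, $\Omega_3=\{(\sigma,\mu):|\sigma|\ge4,\ \mu\ge\frac23(|\sigma|-1)\}$. *)

theory Defs
  imports "HOL-Complex_Analysis.Complex_Analysis"
begin

abbreviation unit_disc :: "complex set" where
  "unit_disc \<equiv> ball 0 1"

definition class_A :: "(complex \<Rightarrow> complex) set" where
  "class_A = {f. f holomorphic_on unit_disc \<and> f 0 = 0 \<and> deriv f 0 = 1}"

text \<open>The value \<open>norm (\<omega> z) = 1\<close> is formally allowed, but by the maximum principle and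
  \<open>\<omega> 0 = 0\<close> it never occurs, so \<open>h\<close> is only evaluated inside the unit disc.\<close>

definition subordinate :: "(complex \<Rightarrow> complex) \<Rightarrow> (complex \<Rightarrow> complex) \<Rightarrow> bool" where
  "subordinate g h \<longleftrightarrow>
     (\<exists>\<omega>. \<omega> holomorphic_on unit_disc \<and> \<omega> 0 = 0 \<and> (\<forall>z\<in>unit_disc. norm (\<omega> z) \<le> 1) \<and>
          (\<forall>z\<in>unit_disc. g z = h (\<omega> z)))"

definition ma_minda :: "(complex \<Rightarrow> complex) \<Rightarrow> bool" where
  "ma_minda \<phi> \<longleftrightarrow>
     \<phi> holomorphic_on unit_disc \<and> inj_on \<phi> unit_disc \<and>
     \<phi> 0 = 1 \<and> deriv \<phi> 0 \<in> \<real> \<and> 0 < Re (deriv \<phi> 0) \<and>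
     \<phi> ` unit_disc \<subseteq> {w. 0 < Re w} \<and>
     cnj ` \<phi> ` unit_disc = \<phi> ` unit_disc \<and>
     (\<forall>w \<in> \<phi> ` unit_disc. closed_segment 1 w \<subseteq> \<phi> ` unit_disc)"

text \<open>Local univalence (\<open>deriv f z \<noteq> 0\<close>) is what makes the quotient \<open>f'' / f'\<close> an analytic
  function; it is stated explicitly because division by zero is total here.\<close>

definition class_C :: "(complex \<Rightarrow> complex) \<Rightarrow> (complex \<Rightarrow> complex) set" where
  "class_C \<phi> = {f \<in> class_A. (\<forall>z\<in>unit_disc. deriv f z \<noteq> 0) \<and>
     subordinate (\<lambda>z. 1 + z * deriv (deriv f) z / deriv f z) \<phi>}"

definition taylor_coeff :: "(complex \<Rightarrow> complex) \<Rightarrow> nat \<Rightarrow> complex" where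
  "taylor_coeff f n = fps_nth (fps_expansion f 0) n"

text \<open>The Taylor coefficients of a Ma-Minda function are real (by its symmetry about the real
  axis, univalence and \<open>\<phi>'(0) > 0\<close>), so taking the real part only changes the type.\<close>

definition real_coeff :: "(complex \<Rightarrow> complex) \<Rightarrow> nat \<Rightarrow> real" where
  "real_coeff \<phi> n = Re (taylor_coeff \<phi> n)"

definition is_local_inverse :: "(complex \<Rightarrow> complex) \<Rightarrow> (complex \<Rightarrow> complex) \<Rightarrow> bool" where
  "is_local_inverse f g \<longleftrightarrow> g analytic_on {0} \<and> g 0 = 0 \<and>
     (\<forall>\<^sub>F w in nhds 0. f (g w) = w) \<and> (\<forall>\<^sub>F z in nhds 0. g (f z) = z)"

text \<open>The local inverse exists and its germ at \<open>0\<close> is unique (see the two lemmas below), so the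
  coefficients do not depend on the choice.\<close>

definition inverse_coeff :: "(complex \<Rightarrow> complex) \<Rightarrow> nat \<Rightarrow> complex" where
  "inverse_coeff f n = taylor_coeff (SOME g. is_local_inverse f g) n"

lemma ex_local_inverse:
  assumes "f \<in> class_A"
  shows "\<exists>g. is_local_inverse f g"
proof -
  have hol: "f holomorphic_on unit_disc" and f0: "f 0 = 0" and d: "deriv f 0 \<noteq> 0"
    using assms by (auto simp: class_A_def)
  obtain r where r: "r > 0" "ball 0 r \<subseteq> unit_disc" "open (f ` ball 0 r)" "inj_on f (ball 0 r)"
    using has_complex_derivative_locally_invertible[OF hol _ _ d] by auto
  have hr: "f holomorphic_on ball 0 r"
    using hol r(2) holomorphic_on_subset by blast
  obtain g where g: "g holomorphic_on (f ` ball 0 r)" "\<And>z. z \<in> ball 0 r \<Longrightarrow> g (f z) = z"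
    by (rule holomorphic_has_inverse[OF hr open_ball r(4)]) (rule that)
  have z: "0 \<in> ball (0::complex) r" using r(1) by simp
  have z': "0 \<in> f ` ball 0 r" using z f0 by force
  have "g analytic_on {0}"
    using g(1) r(3) z' analytic_at by blast
  moreover have "g 0 = 0" using g(2)[OF z] f0 by simp
  moreover have "\<forall>\<^sub>F w in nhds 0. f (g w) = w"
    using eventually_nhds_in_open[OF r(3) z'] by eventually_elim (auto simp: g(2))
  moreover have "\<forall>\<^sub>F w in nhds 0. g (f w) = w"
    using eventually_nhds_in_open[OF open_ball z] by eventually_elim (auto simp: g(2))
  ultimately show ?thesis unfolding is_local_inverse_def by blast
qed

lemma local_inverse_unique:
  assumes "is_local_inverse f g" "is_local_inverse f h"
  shows "\<forall>\<^sub>F w in nhds 0. g w = h w"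
proof -
  have "isCont h 0" and h0: "h 0 = 0"
    using assms(2) by (auto simp: is_local_inverse_def analytic_at_imp_isCont)
  then have "filterlim h (nhds 0) (nhds 0)"
    using tendsto_at_iff_tendsto_nhds[of h 0] by (simp add: isCont_def)
  moreover have "\<forall>\<^sub>F z in nhds 0. g (f z) = z"
    using assms(1) by (auto simp: is_local_inverse_def)
  ultimately have "\<forall>\<^sub>F w in nhds 0. g (f (h w)) = h w"
    by (rule filterlim_iff[THEN iffD1, rule_format])
  moreover have "\<forall>\<^sub>F w in nhds 0. f (h w) = w"
    using assms(2) by (auto simp: is_local_inverse_def)
  ultimately show ?thesis by eventually_elim simp
qed

definition Omega1 :: "(real \<times> real) set" where
  "Omega1 = {(\<sigma>, \<mu>). \<bar>\<sigma>\<bar> \<le> 2 \<and> \<mu> \<ge> 1}"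

definition Omega2 :: "(real \<times> real) set" where
  "Omega2 = {(\<sigma>, \<mu>). 2 \<le> \<bar>\<sigma>\<bar> \<and> \<bar>\<sigma>\<bar> \<le> 4 \<and> \<mu> \<ge> 1 / 12 * (\<sigma>\<^sup>2 + 8)}"

definition Omega3 :: "(real \<times> real) set" where
  "Omega3 = {(\<sigma>, \<mu>). \<bar>\<sigma>\<bar> \<ge> 4 \<and> \<mu> \<ge> 2 / 3 * (\<bar>\<sigma>\<bar> - 1)}"

end

(* Write f in C(phi) through a Schwarz function omega(z) = c1 z + c2 z^2 + c3 z^3 + ...: comparing
   coefficients, b3 = -(B1 c2 + (B2 - 2 B1^2) c1^2) / 6 and
   b4 = -(B1 / 12) (c3 + sigma4 c1 c2 + mu4 c1^3).  Since |c2| <= 1 - |c1|^2, the hypothesis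
   B1 <= |2 B1^2 - B2| bounds b3 by its value at |c1| = 1; the bound for b4 is the
   Prokhorov-Szynal inequality |c3 + sigma c1 c2 + mu c1^3| <= mu.  By convexity and monotonicity
   in mu it is enough to prove the latter on the parabola 12 mu = sigma^2 + 8, |sigma| >= 2,
   where the Schur parametrisation of (c1, c2, c3) reduces it to a polynomial inequality.
   For omega(z) = i z the squares of b3 and b4 are both maximal and have opposite signs. *)
theory Submission
  imports Defs
begin

text \<open>Here \<open>4 * s = \<sigma>\<close>, \<open>t = |c1|\<^sup>2\<close>, \<open>p = |\<zeta>|\<^sup>2\<close> and \<open>u = Re \<zeta>\<close>. After completing the square
  in \<open>u\<close>, the remainder vanishes at \<open>t = 1\<close> and is concave in \<open>t\<close>.\<close>

lemma schur_polynomial_nonneg: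
  fixes s \<mu> t p u :: real
  assumes s: "4 * s\<^sup>2 = 3 * \<mu> - 2" and "\<mu> \<ge> 1" "0 \<le> t" "t \<le> 1" "0 \<le> p" "p \<le> 1"
  shows "0 \<le> \<mu>\<^sup>2 * (1 + t + t\<^sup>2) - 2 * \<mu> * (1 - p) + (1 - t) * (1 - p)\<^sup>2
     - t * (1 - t) * (16 * s\<^sup>2 * p - 8 * s * p * u + p\<^sup>2) - 2 * \<mu> * t\<^sup>2 * (4 * s * u - 2 * u\<^sup>2 + p)"
    (is "0 \<le> ?Q")
proof -
  have "\<mu> * ?Q = 4 * (\<mu> * t * u - s * (\<mu> * t - (1 - t) * p))\<^sup>2
     + (\<mu> - 1) * (1 - t) * (\<mu> * (\<mu> - 1) + 2 * p * (\<mu> - p) + 2 * t * (\<mu> - p)\<^sup>2)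
     + (3 * \<mu> - 2 - 4 * s\<^sup>2) * (4 * t * (1 - t) * p * \<mu> + (\<mu> * t - (1 - t) * p)\<^sup>2)"
    by algebra
  also have "\<dots> \<ge> 0"
    using assms by (auto intro!: add_nonneg_nonneg mult_nonneg_nonneg)
  finally show ?thesis using assms(2) by (simp add: zero_le_mult_iff)
qed

lemma norm_schur_form_le:
  fixes \<sigma> \<mu> x :: real and \<zeta> :: complex
  assumes \<sigma>: "12 * \<mu> = \<sigma>\<^sup>2 + 8" and "\<mu> \<ge> 1" "0 \<le> x" "x \<le> 1" "norm \<zeta> \<le> 1"
  shows "norm (of_real (x * (1 - x\<^sup>2)) * (of_real \<sigma> * \<zeta> - \<zeta>\<^sup>2) + of_real (\<mu> * x ^ 3))
         \<le> \<mu> - (1 - x\<^sup>2) * (1 - (norm \<zeta>)\<^sup>2)" (is "norm ?W \<le> ?R")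
proof (rule power2_le_imp_le)
  define s u v p t where "s = \<sigma> / 4" and "u = Re \<zeta>" and "v = Im \<zeta>" and "p = u\<^sup>2 + v\<^sup>2" and "t = x\<^sup>2"
  have p: "p = (norm \<zeta>)\<^sup>2" by (simp add: p_def u_def v_def cmod_power2)
  have p01: "0 \<le> p" "p \<le> 1" using assms by (auto simp: p abs_square_le_1)
  have t01: "0 \<le> t" "t \<le> 1" using assms by (auto simp: t_def abs_square_le_1)
  have "(1 - t) * (1 - p) \<le> 1 * 1" using p01 t01 by (intro mult_mono) auto
  then show "0 \<le> ?R" using assms unfolding p[symmetric] t_def[symmetric] by simp
  have s: "4 * s\<^sup>2 = 3 * \<mu> - 2" using \<sigma> by (simp add: s_def power2_eq_square field_simps)
  have Re: "Re ?W = x * (1 - t) * (4 * s * u - (u\<^sup>2 - v\<^sup>2)) + \<mu> * x ^ 3"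
    and Im: "Im ?W = x * (1 - t) * (4 * s * v - 2 * u * v)"
    by (auto simp: s_def u_def v_def t_def power2_eq_square algebra_simps)
  have W: "(norm ?W)\<^sup>2 = (x * (1 - t))\<^sup>2 * (p * (16 * s\<^sup>2 - 8 * s * u + p))
      + 2 * (x * (1 - t)) * (\<mu> * x ^ 3) * (4 * s * u - 2 * u\<^sup>2 + p) + (\<mu> * x ^ 3)\<^sup>2"
    unfolding cmod_power2 Re Im p_def by algebra
  have "?R\<^sup>2 - (norm ?W)\<^sup>2 = (\<mu> - (1 - t) * (1 - p))\<^sup>2 - (norm ?W)\<^sup>2"
    by (simp only: p t_def)
  also have "\<dots> = (1 - t) * (\<mu>\<^sup>2 * (1 + t + t\<^sup>2) - 2 * \<mu> * (1 - p) + (1 - t) * (1 - p)\<^sup>2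
     - t * (1 - t) * (16 * s\<^sup>2 * p - 8 * s * p * u + p\<^sup>2) - 2 * \<mu> * t\<^sup>2 * (4 * s * u - 2 * u\<^sup>2 + p))"
    unfolding W unfolding t_def by algebra
  also have "\<dots> \<ge> 0"
    using schur_polynomial_nonneg[OF s assms(2) t01 p01] t01 by (intro mult_nonneg_nonneg) auto
  finally show "(norm ?W)\<^sup>2 \<le> ?R\<^sup>2" by simp
qed

text \<open>The first three Schur parameters are \<open>c1\<close>, \<open>\<zeta>\<close> and \<open>\<eta> / (1 - |\<zeta>|\<^sup>2)\<close>; if \<open>|c1| = 1\<close>, the
  definition forces \<open>c2 = c3 = 0\<close>.\<close>

definition schur_triple :: "complex \<Rightarrow> complex \<Rightarrow> complex \<Rightarrow> bool" where
  "schur_triple c1 c2 c3 \<longleftrightarrow> norm c1 \<le> 1 \<and>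
     (\<exists>\<zeta> \<eta>. norm \<zeta> \<le> 1 \<and> norm \<eta> \<le> 1 - (norm \<zeta>)\<^sup>2 \<and>
        c2 = of_real (1 - (norm c1)\<^sup>2) * \<zeta> \<and> c3 = of_real (1 - (norm c1)\<^sup>2) * (\<eta> - cnj c1 * \<zeta>\<^sup>2))"

lemma schur_triple_norm_c2_le:
  assumes "schur_triple c1 c2 c3"
  shows "norm c2 \<le> 1 - (norm c1)\<^sup>2"
proof -
  obtain \<zeta> where z: "norm c1 \<le> 1" "norm \<zeta> \<le> 1" "c2 = of_real (1 - (norm c1)\<^sup>2) * \<zeta>"
    using assms unfolding schur_triple_def by blast
  have "0 \<le> 1 - (norm c1)\<^sup>2" using z(1) by (simp add: abs_square_le_1)
  then show ?thesis using z(2) unfolding z(3) norm_mult norm_of_real by (simp add: mult_left_le)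
qed

lemma schur_form_rotation:
  fixes e :: complex
  assumes "e * e' = 1"
  shows "y * (\<eta> - x * e' * (e\<^sup>2 * \<xi>)\<^sup>2) + \<sigma> * (x * e) * (y * (e\<^sup>2 * \<xi>)) + \<mu> * (x * e) ^ 3
    = y * \<eta> + e ^ 3 * (x * y * (\<sigma> * \<xi> - \<xi>\<^sup>2) + \<mu> * x ^ 3)"
  using assms by algebra

lemma prokhorov_szynal_parabola:
  fixes \<sigma> \<mu> :: real
  assumes "schur_triple c1 c2 c3" and \<sigma>: "12 * \<mu> = \<sigma>\<^sup>2 + 8" "\<mu> \<ge> 1"
  shows "norm (c3 + of_real \<sigma> * c1 * c2 + of_real \<mu> * c1 ^ 3) \<le> \<mu>"
proof -
  define x where "x = norm c1"
  obtain \<zeta> \<eta> where z: "norm c1 \<le> 1" "norm \<zeta> \<le> 1" "norm \<eta> \<le> 1 - (norm \<zeta>)\<^sup>2"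
    and c2: "c2 = of_real (1 - x\<^sup>2) * \<zeta>" and c3: "c3 = of_real (1 - x\<^sup>2) * (\<eta> - cnj c1 * \<zeta>\<^sup>2)"
    using assms(1) unfolding schur_triple_def x_def by blast
  define e where "e = cis (Arg c1)"
  have c1: "c1 = of_real x * e" unfolding x_def e_def by (metis rcis_cmod_Arg rcis_def)
  have ee: "e * cnj e = 1" and e1: "norm e = 1"
    by (auto simp: e_def cis_cnj cis_mult)
  define \<xi> where "\<xi> = cnj e ^ 2 * \<zeta>"
  have \<zeta>: "\<zeta> = e ^ 2 * \<xi>" using ee unfolding \<xi>_def by algebra
  have n\<xi>: "norm \<xi> = norm \<zeta>" using e1 by (simp add: \<zeta> norm_mult norm_power)
  have x: "0 \<le> x" "x \<le> 1" using z(1) by (auto simp: x_def)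
  have y: "0 \<le> 1 - x\<^sup>2" using x by (simp add: abs_square_le_1)
  have "c3 + of_real \<sigma> * c1 * c2 + of_real \<mu> * c1 ^ 3 = of_real (1 - x\<^sup>2) * \<eta> +
      e ^ 3 * (of_real (x * (1 - x\<^sup>2)) * (of_real \<sigma> * \<xi> - \<xi>\<^sup>2) + of_real (\<mu> * x ^ 3))"
    unfolding c2 c3 c1 \<zeta> of_real_mult of_real_power complex_cnj_mult complex_cnj_complex_of_real
    by (rule schur_form_rotation[OF ee])
  also have "norm \<dots> \<le> norm (of_real (1 - x\<^sup>2) * \<eta>)
      + norm (e ^ 3 * (of_real (x * (1 - x\<^sup>2)) * (of_real \<sigma> * \<xi> - \<xi>\<^sup>2) + of_real (\<mu> * x ^ 3)))"
    by (rule norm_triangle_ineq)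
  also have "\<dots> = (1 - x\<^sup>2) * norm \<eta>
      + norm (of_real (x * (1 - x\<^sup>2)) * (of_real \<sigma> * \<xi> - \<xi>\<^sup>2) + of_real (\<mu> * x ^ 3))"
    unfolding norm_mult norm_power e1 norm_of_real using y by simp
  also have "\<dots> \<le> (1 - x\<^sup>2) * (1 - (norm \<zeta>)\<^sup>2) + (\<mu> - (1 - x\<^sup>2) * (1 - (norm \<xi>)\<^sup>2))"
    using y z x \<sigma> n\<xi> by (intro add_mono mult_left_mono norm_schur_form_le) auto
  finally show ?thesis using n\<xi> by simp
qed

lemma schur_triple_minus_c2:
  assumes "schur_triple c1 c2 c3"
  shows "schur_triple c1 (- c2) c3"
proof -
  obtain \<zeta> \<eta> where "norm c1 \<le> 1" "norm \<zeta> \<le> 1" "norm \<eta> \<le> 1 - (norm \<zeta>)\<^sup>2"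
    "c2 = of_real (1 - (norm c1)\<^sup>2) * \<zeta>" "c3 = of_real (1 - (norm c1)\<^sup>2) * (\<eta> - cnj c1 * \<zeta>\<^sup>2)"
    using assms unfolding schur_triple_def by blast
  then show ?thesis
    unfolding schur_triple_def by (intro conjI exI[of _ "- \<zeta>"] exI[of _ \<eta>]) simp_all
qed

lemma prokhorov_szynal:
  fixes \<sigma> \<mu> :: real
  assumes c: "schur_triple c1 c2 c3" and \<sigma>: "(\<sigma>, \<mu>) \<in> Omega1 \<union> Omega2 \<union> Omega3"
  shows "norm (c3 + of_real \<sigma> * c1 * c2 + of_real \<mu> * c1 ^ 3) \<le> \<mu>"
proof -
  have nc1: "norm c1 \<le> 1" using c by (simp add: schur_triple_def)
  have mono: ?thesis if "norm (c3 + of_real \<sigma> * c1 * c2 + of_real \<mu>' * c1 ^ 3) \<le> \<mu>'" "\<mu>' \<le> \<mu>" for \<mu>'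
  proof -
    have "c3 + of_real \<sigma> * c1 * c2 + of_real \<mu> * c1 ^ 3 =
       (c3 + of_real \<sigma> * c1 * c2 + of_real \<mu>' * c1 ^ 3) + of_real (\<mu> - \<mu>') * c1 ^ 3"
      by (simp add: algebra_simps)
    also have "norm \<dots> \<le> \<mu>' + (\<mu> - \<mu>') * 1"
      using that nc1 by (intro norm_triangle_mono)
        (auto simp: norm_mult norm_power simp flip: of_real_diff intro!: mult_left_le power_le_one)
    finally show ?thesis by simp
  qed
  consider "\<bar>\<sigma>\<bar> \<le> 2" "1 \<le> \<mu>" | "2 \<le> \<bar>\<sigma>\<bar>" "(\<sigma>\<^sup>2 + 8) / 12 \<le> \<mu>" | "4 \<le> \<bar>\<sigma>\<bar>" "2 / 3 * (\<bar>\<sigma>\<bar> - 1) \<le> \<mu>"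
    using \<sigma> by (auto simp: Omega1_def Omega2_def Omega3_def)
  then show ?thesis
  proof cases
    case 1
    define l where "l = (2 + \<sigma>) / 4"
    have l: "0 \<le> l" "l \<le> 1" using 1 by (auto simp: l_def)
    have "c3 + of_real \<sigma> * c1 * c2 + of_real 1 * c1 ^ 3 =
        of_real l * (c3 + of_real 2 * c1 * c2 + of_real 1 * c1 ^ 3)
        + of_real (1 - l) * (c3 + of_real (- 2) * c1 * c2 + of_real 1 * c1 ^ 3)"
      by (simp add: l_def field_simps)
    also have "norm \<dots> \<le> l * 1 + (1 - l) * 1"
    proof (intro norm_triangle_mono)
      show "norm (of_real l * (c3 + of_real 2 * c1 * c2 + of_real 1 * c1 ^ 3)) \<le> l * 1"
        using l prokhorov_szynal_parabola[OF c, of 1 2] unfolding norm_mult norm_of_real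
        by (intro mult_mono) auto
      show "norm (of_real (1 - l) * (c3 + of_real (- 2) * c1 * c2 + of_real 1 * c1 ^ 3)) \<le> (1 - l) * 1"
        using l prokhorov_szynal_parabola[OF c, of 1 "-2"] unfolding norm_mult norm_of_real
        by (intro mult_mono) auto
    qed
    finally show ?thesis using 1 by (intro mono[of 1]) auto
  next
    case 2
    have "2\<^sup>2 \<le> \<bar>\<sigma>\<bar>\<^sup>2" using 2(1) by (intro power_mono) auto
    then show ?thesis using 2
      by (intro mono[of "(\<sigma>\<^sup>2 + 8) / 12"] prokhorov_szynal_parabola[OF c]) auto
  next
    case 3
    have ray: "norm (c3 + of_real s * c1 * c2 + of_real (2 / 3 * (s - 1)) * c1 ^ 3) \<le> 2 / 3 * (s - 1)"
      if c: "schur_triple c1 c2 c3" and s: "4 \<le> s" for s c2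
    proof -
      have "norm (c1 * c2 + of_real (2 / 3) * c1 ^ 3)
          \<le> norm c1 * (1 - (norm c1)\<^sup>2) + 2 / 3 * norm c1 ^ 3"
        using schur_triple_norm_c2_le[OF c]
        by (intro norm_triangle_mono) (auto simp: norm_mult norm_power norm_divide
            intro!: mult_left_mono)
      also have "\<dots> \<le> 2 / 3"
      proof -
        have "2 / 3 - (norm c1 * (1 - (norm c1)\<^sup>2) + 2 / 3 * norm c1 ^ 3)
            = (1 - norm c1)\<^sup>2 * (2 + norm c1) / 3"
          by (simp add: power2_eq_square power3_eq_cube field_simps)
        also have "\<dots> \<ge> 0" by simp
        finally show ?thesis by simp
      qed
      finally have d: "norm (c1 * c2 + of_real (2 / 3) * c1 ^ 3) \<le> 2 / 3" .
      have "c3 + of_real s * c1 * c2 + of_real (2 / 3 * (s - 1)) * c1 ^ 3 =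
        (c3 + of_real 4 * c1 * c2 + of_real 2 * c1 ^ 3)
            + of_real (s - 4) * (c1 * c2 + of_real (2 / 3) * c1 ^ 3)"
        by (simp add: field_simps)
      also have "norm \<dots> \<le> 2 + (s - 4) * (2 / 3)"
      proof (rule norm_triangle_mono)
        show "norm (c3 + of_real 4 * c1 * c2 + of_real 2 * c1 ^ 3) \<le> 2"
          using prokhorov_szynal_parabola[OF c, of 2 4] by simp
        show "norm (of_real (s - 4) * (c1 * c2 + of_real (2 / 3) * c1 ^ 3)) \<le> (s - 4) * (2 / 3)"
          unfolding norm_mult norm_of_real using s d by (intro mult_mono) auto
      qed
      finally show ?thesis by (simp add: field_simps)
    qed
    have "norm (c3 + of_real \<sigma> * c1 * c2 + of_real (2 / 3 * (\<bar>\<sigma>\<bar> - 1)) * c1 ^ 3) \<le> 2 / 3 * (\<bar>\<sigma>\<bar> - 1)"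
      using ray[OF c, of "\<bar>\<sigma>\<bar>"] ray[OF schur_triple_minus_c2[OF c], of "\<bar>\<sigma>\<bar>"] 3(1)
      by (cases "0 \<le> \<sigma>") auto
    then show ?thesis using 3 by (intro mono[of "2 / 3 * (\<bar>\<sigma>\<bar> - 1)"])
  qed
qed

lemma schur_step:
  assumes hol: "g holomorphic_on unit_disc" and le: "\<And>z. norm z < 1 \<Longrightarrow> norm (g z) \<le> 1"
  obtains h where "h holomorphic_on unit_disc" "\<And>z. norm z < 1 \<Longrightarrow> norm (h z) \<le> 1"
    "\<forall>z\<in>unit_disc. g z - g 0 = z * h z * (1 - cnj (g 0) * g z)"
proof (cases "\<exists>z. norm z < 1 \<and> norm (g z) = 1")
  case True
  then obtain a where a: "norm a < 1" "norm (g a) = 1" by blast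
  have "g constant_on unit_disc"
    by (rule maximum_modulus_principle[OF hol, of "unit_disc" a]) (use a le in auto)
  then obtain k where "\<forall>z\<in>unit_disc. g z = k" unfolding constant_on_def by blast
  then have "\<forall>z\<in>unit_disc. g z - g 0 = z * 0 * (1 - cnj (g 0) * g z)" by simp
  then show ?thesis by (intro that[of "\<lambda>_. 0"])
      (simp_all only: holomorphic_on_const norm_zero zero_le_one)
next
  case False
  define a where "a = g 0"
  have lt: "norm (g z) < 1" if "norm z < 1" for z
    using False le[OF that] that by force
  then have a1: "norm a < 1" by (simp add: a_def)
  define F where "F = Moebius_function 0 a \<circ> g"
  have F: "F holomorphic_on ball 0 1"
    unfolding F_def using lt
        by (intro holomorphic_on_compose_gen[OF hol Moebius_function_holomorphic[OF a1]]) auto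
  have F0: "F 0 = 0" by (simp add: F_def a_def Moebius_function_eq_zero)
  have Flt: "norm (F z) < 1" if "norm z < 1" for z
    using Moebius_function_norm_lt_1[OF a1 lt[OF that]] by (simp add: F_def)
  obtain h where h: "h holomorphic_on ball 0 1" "\<And>z. norm z < 1 \<Longrightarrow> F z = z * h z" "deriv F 0 = h 0"
    using Schwarz3[OF F F0] by blast
  show ?thesis
  proof (rule that[OF h(1)])
    show "norm (h z) \<le> 1" if z: "norm z < 1" for z
      using Schwarz_Lemma(1,2)[OF F F0 Flt z] h(2)[OF z] h(3)
      by (cases "z = 0") (auto simp: norm_mult)
    show "\<forall>z\<in>unit_disc. g z - g 0 = z * h z * (1 - cnj (g 0) * g z)"
    proof
      fix z :: complex assume "z \<in> unit_disc"
      then have z: "norm z < 1" by simp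
      have "norm (cnj a * g z) < 1"
        using a1 lt[OF z] by (metis complex_mod_cnj norm_mult_less mult_1)
      then have "1 - cnj a * g z \<noteq> 0" by force
      then show "g z - g 0 = z * h z * (1 - cnj (g 0) * g z)"
        unfolding h(2)[OF z, symmetric] by (simp add: F_def Moebius_function_simple a_def)
    qed
  qed
qed

lemma has_fps_expansion_taylor:
  assumes "f holomorphic_on unit_disc"
  shows "f has_fps_expansion fps_expansion f 0"
  by (rule has_fps_expansion_fps_expansion[OF open_ball _ assms]) simp

lemma eventually_unit_disc: "\<forall>\<^sub>F z in nhds (0::complex). norm z < 1"
  using eventually_nhds_in_open[of "ball 0 1" "0::complex"] by simp

lemma fps_nth_fps_expansion_0: "fps_nth (fps_expansion f 0) 0 = f 0"
  by (simp add: fps_expansion_def)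

lemma schur_step_fps:
  assumes "g holomorphic_on unit_disc" "h holomorphic_on unit_disc"
    and "\<forall>z\<in>unit_disc. g z - g 0 = z * h z * (1 - cnj (g 0) * g z)"
  shows "fps_expansion g 0 - fps_const (g 0) =
    fps_X * fps_expansion h 0 * (1 - fps_const (cnj (g 0)) * fps_expansion g 0)"
proof (rule fps_expansion_unique_complex)
  show "(\<lambda>z. g z - g 0) has_fps_expansion fps_expansion g 0 - fps_const (g 0)"
    by (intro fps_expansion_intros has_fps_expansion_taylor assms)
  have "(\<lambda>z. z * h z * (1 - cnj (g 0) * g z)) has_fps_expansion
     fps_X * fps_expansion h 0 * (1 - fps_const (cnj (g 0)) * fps_expansion g 0)"
    by (intro fps_expansion_intros has_fps_expansion_taylor assms)
  moreover have "\<forall>\<^sub>F z in nhds 0. z * h z * (1 - cnj (g 0) * g z) = g z - g 0"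
    using eventually_unit_disc by eventually_elim (simp add: assms(3))
  ultimately show "(\<lambda>z. g z - g 0) has_fps_expansion
     fps_X * fps_expansion h 0 * (1 - fps_const (cnj (g 0)) * fps_expansion g 0)"
    by (rule has_fps_expansion_cong[THEN iffD1, OF _ refl, rotated])
qed

lemma schur_step_coeffs:
  assumes "g holomorphic_on unit_disc" "h holomorphic_on unit_disc"
    and "\<forall>z\<in>unit_disc. g z - g 0 = z * h z * (1 - cnj (g 0) * g z)"
  shows "taylor_coeff g 1 = h 0 * of_real (1 - (norm (g 0))\<^sup>2)"
    and "taylor_coeff g 2 = taylor_coeff h 1 * of_real (1 - (norm (g 0))\<^sup>2)
        - h 0 * cnj (g 0) * taylor_coeff g 1"
    and "taylor_coeff g 3 = taylor_coeff h 2 * of_real (1 - (norm (g 0))\<^sup>2)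
           - taylor_coeff h 1 * cnj (g 0) * taylor_coeff g 1 - h 0 * cnj (g 0) * taylor_coeff g 2"
proof -
  let ?G = "fps_expansion g 0" and ?H = "fps_expansion h 0"
  have "fps_nth (?G - fps_const (g 0)) (Suc n) = fps_nth (?H * (1 - fps_const (cnj (g 0)) * ?G)) n" for n
    using arg_cong[OF schur_step_fps[OF assms], of "\<lambda>F. fps_nth F (Suc n)"]
        by (simp add: mult.assoc fps_X_mult_nth)
  then have *: "fps_nth ?G (Suc n)
      = (\<Sum>i\<le>n. fps_nth ?H i * fps_nth (1 - fps_const (cnj (g 0)) * ?G) (n - i))" for n
    by (simp add: fps_mult_nth atLeast0AtMost)
  have n2: "of_real (1 - (norm (g 0))\<^sup>2) = 1 - g 0 * cnj (g 0)"
    by (simp add: complex_norm_square[symmetric])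
  show "taylor_coeff g 1 = h 0 * of_real (1 - (norm (g 0))\<^sup>2)"
    using *[of 0] unfolding taylor_coeff_def n2 by (simp add: fps_nth_fps_expansion_0 algebra_simps)
  show "taylor_coeff g 2 = taylor_coeff h 1 * of_real (1 - (norm (g 0))\<^sup>2)
      - h 0 * cnj (g 0) * taylor_coeff g 1"
    using *[of 1] unfolding taylor_coeff_def n2
    by (simp add: fps_nth_fps_expansion_0 algebra_simps numeral_2_eq_2)
  show "taylor_coeff g 3 = taylor_coeff h 2 * of_real (1 - (norm (g 0))\<^sup>2)
           - taylor_coeff h 1 * cnj (g 0) * taylor_coeff g 1 - h 0 * cnj (g 0) * taylor_coeff g 2"
    using *[of 2] unfolding taylor_coeff_def n2
    by (simp add: fps_nth_fps_expansion_0 algebra_simps numeral_2_eq_2 numeral_3_eq_3)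
qed

lemma schwarz_function_schur_triple:
  assumes "\<omega> holomorphic_on unit_disc" "\<omega> 0 = 0" "\<And>z. norm z < 1 \<Longrightarrow> norm (\<omega> z) \<le> 1"
  shows "schur_triple (taylor_coeff \<omega> 1) (taylor_coeff \<omega> 2) (taylor_coeff \<omega> 3)"
proof -
  obtain h1 where h1: "h1 holomorphic_on unit_disc" "\<And>z. norm z < 1 \<Longrightarrow> norm (h1 z) \<le> 1"
    "\<forall>z\<in>unit_disc. \<omega> z - \<omega> 0 = z * h1 z * (1 - cnj (\<omega> 0) * \<omega> z)"
    using schur_step[OF assms(1,3)] by metis
  obtain h2 where h2: "h2 holomorphic_on unit_disc" "\<And>z. norm z < 1 \<Longrightarrow> norm (h2 z) \<le> 1"
    "\<forall>z\<in>unit_disc. h1 z - h1 0 = z * h2 z * (1 - cnj (h1 0) * h1 z)"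
    using schur_step[OF h1(1,2)] by metis
  obtain h3 where h3: "h3 holomorphic_on unit_disc" "\<And>z. norm z < 1 \<Longrightarrow> norm (h3 z) \<le> 1"
    "\<forall>z\<in>unit_disc. h2 z - h2 0 = z * h3 z * (1 - cnj (h2 0) * h2 z)"
    using schur_step[OF h2(1,2)] by metis
  note c = schur_step_coeffs[OF assms(1) h1(1,3)]
  note d = schur_step_coeffs[OF h1(1) h2(1,3)]
  note e = schur_step_coeffs[OF h2(1) h3(1,3)]
  have w: "taylor_coeff \<omega> 1 = h1 0" "taylor_coeff \<omega> 2 = taylor_coeff h1 1" "taylor_coeff \<omega> 3
      = taylor_coeff h1 2"
    using c assms(2) by simp_all
  have c2: "taylor_coeff \<omega> 2 = of_real (1 - (norm (h1 0))\<^sup>2) * h2 0"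
    and c3: "taylor_coeff \<omega> 3
        = of_real (1 - (norm (h1 0))\<^sup>2) * (taylor_coeff h2 1 - cnj (h1 0) * (h2 0)\<^sup>2)"
    unfolding w d(2) d(1) by (simp_all add: power2_eq_square algebra_simps)
  have "norm (h2 0) \<le> 1" "norm (h1 0) \<le> 1" "norm (h3 0) \<le> 1" using h1(2) h2(2) h3(2) by auto
  moreover have "0 \<le> 1 - (norm (h2 0))\<^sup>2" using \<open>norm (h2 0) \<le> 1\<close> by (simp add: abs_square_le_1)
  ultimately have "norm (taylor_coeff h2 1) \<le> 1 - (norm (h2 0))\<^sup>2"
    unfolding e(1) norm_mult norm_of_real by (simp add: mult_left_le_one_le)
  with \<open>norm (h2 0) \<le> 1\<close> \<open>norm (h1 0) \<le> 1\<close> show ?thesis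
    unfolding schur_triple_def w(1) using c2 c3 by blast
qed

lemma fps_mult_nth_2_3_4:
  fixes F G :: "'a::comm_ring_1 fps"
  shows "fps_nth (F * G) 2 = fps_nth F 0 * fps_nth G 2 + fps_nth F 1 * fps_nth G 1
      + fps_nth F 2 * fps_nth G 0"
    and "fps_nth (F * G) 3 = fps_nth F 0 * fps_nth G 3 + fps_nth F 1 * fps_nth G 2
        + fps_nth F 2 * fps_nth G 1 + fps_nth F 3 * fps_nth G 0"
    and "fps_nth (F * G) 4 = fps_nth F 0 * fps_nth G 4 + fps_nth F 1 * fps_nth G 3
        + fps_nth F 2 * fps_nth G 2 + fps_nth F 3 * fps_nth G 1 + fps_nth F 4 * fps_nth G 0"
  by (simp_all add: fps_mult_nth eval_nat_numeral)

lemma fps_compose_nths: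
  fixes F G :: "'a::comm_ring_1 fps"
  assumes "fps_nth G 0 = 0"
  shows "fps_nth (F oo G) 1 = fps_nth F 1 * fps_nth G 1"
    and "fps_nth (F oo G) 2 = fps_nth F 1 * fps_nth G 2 + fps_nth F 2 * fps_nth G 1 ^ 2"
    and "fps_nth (F oo G) 3 = fps_nth F 1 * fps_nth G 3 + 2 * fps_nth F 2 * fps_nth G 1 * fps_nth G 2
           + fps_nth F 3 * fps_nth G 1 ^ 3"
    and "fps_nth (F oo G) 4 = fps_nth F 1 * fps_nth G 4
           + fps_nth F 2 * (2 * fps_nth G 1 * fps_nth G 3 + fps_nth G 2 ^ 2)
           + 3 * fps_nth F 3 * fps_nth G 1 ^ 2 * fps_nth G 2 + fps_nth F 4 * fps_nth G 1 ^ 4"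
proof -
  have s: "{0..1::nat} = {0,1}" "{0..2::nat} = {0,1,2}" "{0..3::nat} = {0,1,2,3}" "{0..4::nat}
      = {0,1,2,3,4}" by auto
  have p: "G ^ 2 = G * G" "G ^ 3 = G * (G * G)" "G ^ 4 = G * (G * (G * G))"
    by (simp_all add: eval_nat_numeral)
  note m = fps_compose_nth s p fps_mult_nth_2_3_4 assms
  show "fps_nth (F oo G) 1 = fps_nth F 1 * fps_nth G 1"
    by (simp add: fps_compose_nth)
  show "fps_nth (F oo G) 2 = fps_nth F 1 * fps_nth G 2 + fps_nth F 2 * fps_nth G 1 ^ 2"
    by (simp add: m power2_eq_square)
  show "fps_nth (F oo G) 3 = fps_nth F 1 * fps_nth G 3 + 2 * fps_nth F 2 * fps_nth G 1 * fps_nth G 2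
           + fps_nth F 3 * fps_nth G 1 ^ 3"
    by (simp add: m power2_eq_square power3_eq_cube algebra_simps)
  show "fps_nth (F oo G) 4 = fps_nth F 1 * fps_nth G 4
           + fps_nth F 2 * (2 * fps_nth G 1 * fps_nth G 3 + fps_nth G 2 ^ 2)
           + 3 * fps_nth F 3 * fps_nth G 1 ^ 2 * fps_nth G 2 + fps_nth F 4 * fps_nth G 1 ^ 4"
    by (simp add: m power2_eq_square power4_eq_xxxx algebra_simps)
qed

lemma inverse_coeffs_taylor:
  assumes "f \<in> class_A"
  shows "inverse_coeff f 3 = 2 * taylor_coeff f 2 ^ 2 - taylor_coeff f 3"
    and "inverse_coeff f 4 = - 5 * taylor_coeff f 2 ^ 3 + 5 * taylor_coeff f 2 * taylor_coeff f 3
        - taylor_coeff f 4"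
proof -
  define g where "g = (SOME g. is_local_inverse f g)"
  have g: "is_local_inverse f g"
    unfolding g_def by (rule someI_ex[OF ex_local_inverse[OF assms]])
  define F G where "F = fps_expansion f 0" and "G = fps_expansion g 0"
  have F: "f has_fps_expansion F"
    using assms unfolding F_def by (intro has_fps_expansion_taylor) (simp add: class_A_def)
  have G: "g has_fps_expansion G"
    using g unfolding G_def is_local_inverse_def by (intro analytic_at_imp_has_fps_expansion_0) simp
  have G0: "fps_nth G 0 = 0"
    using g by (simp add: G_def fps_nth_fps_expansion_0 is_local_inverse_def)
  have F1: "fps_nth F 1 = 1"
    using assms by (simp add: F_def fps_expansion_def class_A_def)
  have "\<forall>\<^sub>F w in nhds 0. (f \<circ> g) w = w"
    using g by (simp add: is_local_inverse_def)
  then have "(f \<circ> g) has_fps_expansion fps_X \<longleftrightarrow> (\<lambda>w. w) has_fps_expansion (fps_X :: complex fps)"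
    by (intro has_fps_expansion_cong) auto
  then have "F oo G = fps_X"
    using has_fps_expansion_compose[OF F G G0] fps_expansion_unique_complex has_fps_expansion_fps_X
        by blast
  then have n: "fps_nth (F oo G) n = fps_nth fps_X n" for n by simp
  have G1: "fps_nth G 1 = 1" using n[of 1] F1 by (simp add: fps_compose_nths(1)[OF G0, simplified])
  have G2: "fps_nth G 2 = - fps_nth F 2"
    using n[of 2] unfolding fps_compose_nths[OF G0] F1 G1 by (simp add: eq_neg_iff_add_eq_0)
  have G3: "fps_nth G 3 = 2 * fps_nth F 2 ^ 2 - fps_nth F 3"
    using n[of 3] unfolding fps_compose_nths[OF G0] F1 G1 G2
        by (simp add: power2_eq_square algebra_simps add_eq_0_iff)
  have "fps_nth G 4 = - 5 * fps_nth F 2 ^ 3 + 5 * fps_nth F 2 * fps_nth F 3 - fps_nth F 4"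
    using n[of 4] unfolding fps_compose_nths[OF G0] F1 G1 G2 G3
    by (simp add: power2_eq_square power3_eq_cube algebra_simps add_eq_0_iff)
  with G3 show "inverse_coeff f 3 = 2 * taylor_coeff f 2 ^ 2 - taylor_coeff f 3"
    "inverse_coeff f 4 = - 5 * taylor_coeff f 2 ^ 3 + 5 * taylor_coeff f 2 * taylor_coeff f 3
        - taylor_coeff f 4"
    by (simp_all add: inverse_coeff_def taylor_coeff_def F_def G_def g_def)
qed

lemma convex_subordination_coeffs:
  assumes f: "f \<in> class_A" "\<forall>z\<in>unit_disc. deriv f z \<noteq> 0"
    and \<phi>: "\<phi> holomorphic_on unit_disc" "\<phi> 0 = 1"
    and \<omega>: "\<omega> holomorphic_on unit_disc" "\<omega> 0 = 0"
    and eq: "\<forall>z\<in>unit_disc. 1 + z * deriv (deriv f) z / deriv f z = \<phi> (\<omega> z)"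
  defines "A \<equiv> taylor_coeff f" and "B \<equiv> taylor_coeff \<phi>" and "c \<equiv> taylor_coeff \<omega>"
  shows "2 * A 2 = B 1 * c 1"
    and "6 * A 3 = B 1 * c 2 + B 2 * (c 1)\<^sup>2 + 4 * (A 2)\<^sup>2"
    and "12 * A 4 = B 1 * c 3 + 2 * B 2 * c 1 * c 2 + B 3 * c 1 ^ 3 + 18 * A 2 * A 3 - 8 * A 2 ^ 3"
proof -
  define F P W where "F = fps_expansion f 0" and "P = fps_expansion \<phi> 0" and "W = fps_expansion \<omega> 0"
  have F: "f has_fps_expansion F" and P: "\<phi> has_fps_expansion P" and W: "\<omega> has_fps_expansion W"
    using f(1) \<phi>(1) \<omega>(1) unfolding F_def P_def W_def by (auto
        intro!: has_fps_expansion_taylor simp: class_A_def)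
  have W0: "fps_nth W 0 = 0" and P0: "fps_nth P 0 = 1" and F1: "fps_nth F (Suc 0) = 1"
    using \<omega> \<phi> f(1)
        by (auto simp: W_def P_def F_def fps_nth_fps_expansion_0 fps_expansion_def class_A_def)
  have 1: "(\<lambda>z. z * deriv (deriv f) z) has_fps_expansion fps_X * fps_deriv (fps_deriv F)"
    by (intro fps_expansion_intros F)
  have PW: "(\<phi> \<circ> \<omega>) has_fps_expansion (P oo W)"
    by (rule has_fps_expansion_compose[OF P W W0])
  have 2: "(\<lambda>z. ((\<phi> \<circ> \<omega>) z - 1) * deriv f z) has_fps_expansion ((P oo W) - 1) * fps_deriv F"
    by (intro has_fps_expansion_mult has_fps_expansion_diff PW has_fps_expansion_deriv
        has_fps_expansion_1 F)
  have "\<forall>\<^sub>F z in nhds 0. z * deriv (deriv f) z = ((\<phi> \<circ> \<omega>) z - 1) * deriv f z"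
    using eventually_unit_disc
  proof eventually_elim
    case (elim z)
    then have "\<phi> (\<omega> z) = 1 + z * deriv (deriv f) z / deriv f z" "deriv f z \<noteq> 0"
      using f(2) eq by auto
    then show ?case by simp
  qed
  from has_fps_expansion_cong[OF this refl] 1 2 have E: "fps_X * fps_deriv (fps_deriv F)
      = ((P oo W) - 1) * fps_deriv F"
    using fps_expansion_unique_complex by blast
  define K where "K = (P oo W) - 1"
  have K: "fps_nth K 0 = 0" "fps_nth K 1 = B 1 * c 1" "fps_nth K 2 = B 1 * c 2 + B 2 * (c 1)\<^sup>2"
    "fps_nth K 3 = B 1 * c 3 + 2 * B 2 * c 1 * c 2 + B 3 * c 1 ^ 3"
    using fps_compose_nths[OF W0, of P] P0
    by (simp_all add: K_def B_def c_def taylor_coeff_def P_def W_def)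
  have n: "fps_nth (fps_X * fps_deriv (fps_deriv F)) n = fps_nth (K * fps_deriv F) n" for n
    by (simp only: E K_def)
  have A: "A k = fps_nth F k" for k by (simp add: A_def F_def taylor_coeff_def)
  show e1: "2 * A 2 = B 1 * c 1"
    using n[of 1] K F1 by (simp add: A eval_nat_numeral)
  have "6 * A 3 = fps_nth K 2 + 2 * A 2 * fps_nth K 1"
    using n[of 2] K F1 unfolding fps_mult_nth_2_3_4 by (simp add: A eval_nat_numeral algebra_simps)
  then show "6 * A 3 = B 1 * c 2 + B 2 * (c 1)\<^sup>2 + 4 * (A 2)\<^sup>2"
    unfolding K(2,3) e1[symmetric] by (simp add: power2_eq_square)
  then have e2: "fps_nth K 2 = 6 * A 3 - 4 * (A 2)\<^sup>2" using K by simp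
  have "12 * A 4 = fps_nth K 3 + 2 * A 2 * fps_nth K 2 + 3 * A 3 * fps_nth K 1"
    using n[of 3] K(1) F1 unfolding fps_mult_nth_2_3_4 by (simp add: A eval_nat_numeral algebra_simps)
  then show "12 * A 4 = B 1 * c 3 + 2 * B 2 * c 1 * c 2 + B 3 * c 1 ^ 3 + 18 * A 2 * A 3 - 8 * A 2 ^ 3"
    unfolding e2 K(4) K(2) e1[symmetric] by (simp add: power2_eq_square power3_eq_cube algebra_simps)
qed

lemma ma_minda_cnj:
  assumes "ma_minda \<phi>" "norm z < 1"
  shows "cnj (\<phi> (cnj z)) = \<phi> z"
proof -
  have \<phi>: "\<phi> holomorphic_on unit_disc" "inj_on \<phi> unit_disc" "\<phi> 0 = 1" "deriv \<phi> 0 \<in> \<real>" "deriv \<phi> 0 \<noteq> 0"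
    "cnj ` \<phi> ` unit_disc = \<phi> ` unit_disc"
    using assms(1) by (auto simp: ma_minda_def)
  obtain g where g: "g holomorphic_on (\<phi> ` unit_disc)"
    "\<And>z. z \<in> unit_disc \<Longrightarrow> deriv \<phi> z * deriv g (\<phi> z) = 1" "\<And>z. z \<in> unit_disc \<Longrightarrow> g (\<phi> z) = z"
    using holomorphic_has_inverse[OF \<phi>(1) open_ball \<phi>(2)] by metis
  define \<psi> where "\<psi> = cnj \<circ> \<phi> \<circ> cnj"
  have "cnj ` unit_disc = unit_disc"
    by (auto simp: image_iff intro!: bexI[of _ "cnj _"])
  then have hol\<psi>: "\<psi> holomorphic_on unit_disc"
    unfolding \<psi>_def using holomorphic_on_compose_cnj_cnj[of \<phi> unit_disc] \<phi>(1) by simp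
  have im: "\<psi> w \<in> \<phi> ` unit_disc" if "norm w < 1" for w
    using that \<phi>(6) unfolding \<psi>_def by (metis comp_apply complex_mod_cnj imageI mem_ball_0)
  have d\<phi>: "(\<phi> has_field_derivative deriv \<phi> 0) (at 0)"
    by (rule holomorphic_derivI[OF \<phi>(1)]) auto
  have d\<psi>: "(\<psi> has_field_derivative deriv \<phi> 0) (at 0)"
    using has_field_derivative_cnj_cnj[of \<phi> "deriv \<phi> 0" 0] d\<phi> \<phi>(4) by (simp add: \<psi>_def Reals_cnj_iff)
  have op: "open (\<phi> ` unit_disc)" by (rule open_mapping_thm3[OF \<phi>(1) open_ball \<phi>(2)])
  have \<psi>0: "\<psi> 0 = 1" by (simp add: \<psi>_def \<phi>(3))
  have "1 \<in> \<phi> ` unit_disc" using \<phi>(3) by (metis centre_in_ball imageI zero_less_one)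
  then have dg: "(g has_field_derivative deriv g 1) (at (\<psi> 0))"
    using holomorphic_derivI[OF g(1) op] \<psi>0 by simp
  define h where "h = g \<circ> \<psi>"
  have holh: "h holomorphic_on unit_disc"
    unfolding h_def by (rule holomorphic_on_compose_gen[OF hol\<psi> g(1)]) (use im in auto)
  have h0: "h 0 = 0" using g(3)[of 0] \<psi>0 \<phi>(3) by (simp add: h_def)
  have hlt: "norm (h w) < 1" if "norm w < 1" for w
    using im[OF that] g(3) by (force simp: h_def)
  have "(h has_field_derivative deriv g 1 * deriv \<phi> 0) (at 0)"
    unfolding h_def by (rule DERIV_chain[OF dg d\<psi>])
  then have dh: "(h has_field_derivative 1) (at 0)"
    using g(2)[of 0] \<phi>(3) by (simp add: mult.commute)
  then have "norm (deriv h 0) = 1" by (simp add: DERIV_imp_deriv)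
  then obtain \<alpha> where \<alpha>: "\<And>z. norm z < 1 \<Longrightarrow> h z = \<alpha> * z"
    using Schwarz_Lemma(3)[OF holh h0 hlt, of 0] by auto
  have "((\<lambda>z. \<alpha> * z) has_field_derivative \<alpha>) (at 0)" by (auto intro!: derivative_eq_intros)
  moreover have "((\<lambda>z. \<alpha> * z) has_field_derivative 1) (at 0)"
    by (rule has_field_derivative_transform_within_open[OF dh, of unit_disc]) (use \<alpha> in auto)
  ultimately have "\<alpha> = 1" by (rule DERIV_unique)
  then have "g (\<psi> z) = z" using \<alpha>[OF assms(2)] by (simp add: h_def)
  then have "\<psi> z = \<phi> z" using im[OF assms(2)] g(3) by auto
  then show ?thesis by (simp add: \<psi>_def)
qed

lemma ma_minda_taylor_coeff_real:
  assumes "ma_minda \<phi>"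
  shows "taylor_coeff \<phi> n = of_real (real_coeff \<phi> n)"
proof -
  have hol: "\<phi> holomorphic_on unit_disc" using assms by (simp add: ma_minda_def)
  have "cnj ((deriv ^^ n) \<phi> (cnj z)) = (deriv ^^ n) \<phi> z" if "norm z < 1" for z
    using that
  proof (induction n arbitrary: z)
    case 0
    then show ?case using ma_minda_cnj[OF assms] by simp
  next
    case (Suc n)
    let ?D = "(deriv ^^ n) \<phi>"
    have "?D holomorphic_on unit_disc" by (rule holomorphic_higher_deriv[OF hol open_ball])
    then have "(?D has_field_derivative deriv ?D (cnj z)) (at (cnj z))"
      by (rule holomorphic_derivI) (use Suc.prems in auto)
    then have "((cnj \<circ> ?D \<circ> cnj) has_field_derivative cnj (deriv ?D (cnj z))) (at z)"
      by (rule has_field_derivative_cnj_cnj)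
    then have "(?D has_field_derivative cnj (deriv ?D (cnj z))) (at z)"
      by (rule has_field_derivative_transform_within_open[of _ _ _ unit_disc]) (use Suc in auto)
    then show ?case by (simp add: DERIV_imp_deriv)
  qed
  from this[of 0] have "(deriv ^^ n) \<phi> 0 \<in> \<real>" by (simp add: Reals_cnj_iff)
  then have "taylor_coeff \<phi> n \<in> \<real>"
    by (auto simp: taylor_coeff_def fps_expansion_def Reals_cnj_iff)
  then show ?thesis by (simp add: real_coeff_def)
qed

lemma ex_convex_subordination:
  assumes "p holomorphic_on unit_disc" "p 0 = 1"
  obtains f where "f \<in> class_A" "\<forall>z\<in>unit_disc. deriv f z \<noteq> 0"
    "\<forall>z\<in>unit_disc. 1 + z * deriv (deriv f) z / deriv f z = p z"
proof -
  have "(\<lambda>z. p z - 1) holomorphic_on ball 0 1" by (intro holomorphic_intros assms)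
  then obtain k where k: "k holomorphic_on ball 0 1" "\<And>z. norm z < 1 \<Longrightarrow> p z - 1 = z * k z"
    using Schwarz3[of "\<lambda>z. p z - 1" 1] assms(2) by auto
  obtain q where "\<And>z. z \<in> ball 0 1 \<Longrightarrow> (q has_field_derivative k z) (at z within ball 0 1)"
    using holomorphic_convex_primitive'[OF convex_ball open_ball k(1)] by blast
  then have q: "(q has_field_derivative k z) (at z)" if "norm z < 1" for z
    using that by (metis at_within_open mem_ball_0 open_ball)
  define e where "e z = exp (q z - q 0)" for z
  have de: "(e has_field_derivative k z * e z) (at z)" if "norm z < 1" for z
    unfolding e_def using q[OF that] by (auto intro!: derivative_eq_intros)
  then have "e holomorphic_on ball 0 1" by (force simp: holomorphic_on_open)
  then obtain r where "\<And>z. z \<in> ball 0 1 \<Longrightarrow> (r has_field_derivative e z) (at z within ball 0 1)"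
    using holomorphic_convex_primitive'[OF convex_ball open_ball] by blast
  then have r: "(r has_field_derivative e z) (at z)" if "norm z < 1" for z
    using that by (metis at_within_open mem_ball_0 open_ball)
  define f where "f z = r z - r 0" for z
  have df: "(f has_field_derivative e z) (at z)" if "norm z < 1" for z
    unfolding f_def using r[OF that] by (auto intro!: derivative_eq_intros)
  have d1: "deriv f z = e z" if "norm z < 1" for z by (rule DERIV_imp_deriv[OF df[OF that]])
  have d2: "deriv (deriv f) z = k z * e z" if "norm z < 1" for z
  proof (rule DERIV_imp_deriv)
    show "(deriv f has_field_derivative k z * e z) (at z)"
      by (rule has_field_derivative_transform_within_open[OF de[OF that], of unit_disc]) (use that d1 in auto)
  qed
  show ?thesis
  proof (rule that)
    have "f holomorphic_on unit_disc" using df by (force simp: holomorphic_on_open)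
    then show "f \<in> class_A" by (simp add: class_A_def f_def d1[unfolded f_def] e_def d1[of 0])
    show "\<forall>z\<in>unit_disc. deriv f z \<noteq> 0" by (simp add: d1 e_def)
    show "\<forall>z\<in>unit_disc. 1 + z * deriv (deriv f) z / deriv f z = p z"
      using k(2) by (simp add: d1 d2 e_def flip: k(2))
  qed
qed

lemma ma_minda_real_coeff_1_pos:
  assumes "ma_minda \<phi>"
  shows "0 < real_coeff \<phi> 1"
  using assms by (simp add: real_coeff_def taylor_coeff_def fps_expansion_def ma_minda_def)

lemma class_C_inverse_coeffs:
  assumes "ma_minda \<phi>" "f \<in> class_A" "\<forall>z\<in>unit_disc. deriv f z \<noteq> 0"
    and \<omega>: "\<omega> holomorphic_on unit_disc" "\<omega> 0 = 0"
    and eq: "\<forall>z\<in>unit_disc. 1 + z * deriv (deriv f) z / deriv f z = \<phi> (\<omega> z)"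
    and B: "B1 = real_coeff \<phi> 1" "B2 = real_coeff \<phi> 2" "B3 = real_coeff \<phi> 3"
    and \<sigma>: "\<sigma> = (4 * B2 - 7 * B1\<^sup>2) / (2 * B1)"
    and \<mu>: "\<mu> = (6 * B1 ^ 3 - 7 * B1 * B2 + 2 * B3) / (2 * B1)"
  defines "c \<equiv> taylor_coeff \<omega>"
  shows "inverse_coeff f 3 = - (of_real B1 * c 2 + of_real (B2 - 2 * B1\<^sup>2) * (c 1)\<^sup>2) / 6"
    and "inverse_coeff f 4 = - of_real B1 / 12 * (c 3 + of_real \<sigma> * c 1 * c 2 + of_real \<mu> * c 1 ^ 3)"
proof -
  have B1: "0 < B1" using ma_minda_real_coeff_1_pos[OF assms(1)] by (simp add: B)
  define b1 b2 b3 where "b1 = complex_of_real B1" "b2 = complex_of_real B2" "b3 = complex_of_real B3"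
  note b = b1_b2_b3_def
  have b1: "b1 \<noteq> 0" using B1 by (simp add: b)
  have hol: "\<phi> holomorphic_on unit_disc" "\<phi> 0 = 1" using assms(1) by (auto simp: ma_minda_def)
  note A = convex_subordination_coeffs[OF assms(2,3) hol \<omega> eq,
      unfolded ma_minda_taylor_coeff_real[OF assms(1)],
      folded B b c_def]
  define a2 a3 a4 where "a2 = taylor_coeff f 2" "a3 = taylor_coeff f 3" "a4 = taylor_coeff f 4"
  note a = a2_a3_a4_def
  have a2: "a2 = b1 * c 1 / 2"
    using A(1) by (simp add: a field_simps)
  have a3: "a3 = (b1 * c 2 + b2 * (c 1)\<^sup>2 + b1\<^sup>2 * (c 1)\<^sup>2) / 6"
    using A(2) unfolding a[symmetric] a2 by (simp add: power_mult_distrib power_divide field_simps)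
  have a4: "a4 = (b1 * c 3 + 2 * b2 * c 1 * c 2 + b3 * c 1 ^ 3 + 18 * a2 * a3 - 8 * a2 ^ 3) / 12"
    using A(3) unfolding a[symmetric] by (simp add: mult.commute[of a4])
  show "inverse_coeff f 3 = - (of_real B1 * c 2 + of_real (B2 - 2 * B1\<^sup>2) * (c 1)\<^sup>2) / 6"
    unfolding inverse_coeffs_taylor[OF assms(2)] a[symmetric] of_real_diff of_real_mult of_real_power b[symmetric] a3 a2
    by (simp add: field_simps power2_eq_square)
  have \<sigma>': "b1 * of_real \<sigma> = 2 * b2 - 7 / 2 * b1\<^sup>2"
    and \<mu>': "b1 * of_real \<mu> = 3 * b1 ^ 3 - 7 / 2 * b1 * b2 + b3"
    using b1 B1 unfolding \<sigma> \<mu> by (simp_all add: b field_simps power2_eq_square)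
  have "- 5 * a2 ^ 3 + 5 * a2 * a3 - a4 = - (b1 * c 3 + (2 * b2 - 7 / 2 * b1\<^sup>2) * (c 1 * c 2)
      + (3 * b1 ^ 3 - 7 / 2 * b1 * b2 + b3) * c 1 ^ 3) / 12"
    unfolding a4 a3 a2 by (simp add: field_simps power2_eq_square power3_eq_cube)
  also have "\<dots> = - b1 / 12 * (c 3 + of_real \<sigma> * c 1 * c 2 + of_real \<mu> * c 1 ^ 3)"
    unfolding \<sigma>'[symmetric] \<mu>'[symmetric] by (simp add: field_simps)
  finally show "inverse_coeff f 4
      = - of_real B1 / 12 * (c 3 + of_real \<sigma> * c 1 * c 2 + of_real \<mu> * c 1 ^ 3)"
    unfolding inverse_coeffs_taylor[OF assms(2)] a[symmetric] b[symmetric] .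
qed

lemma taylor_coeff_mult_ident:
  "taylor_coeff (\<lambda>z. a * z) n = (if n = 1 then a else 0)"
proof -
  have "(\<lambda>z. a * z) has_fps_expansion fps_const a * fps_X"
    by (intro fps_expansion_intros)
  moreover have "(\<lambda>z. a * z) has_fps_expansion fps_expansion (\<lambda>z. a * z) 0"
    by (intro has_fps_expansion_taylor holomorphic_intros)
  ultimately have "fps_expansion (\<lambda>z. a * z) 0 = fps_const a * fps_X"
    using fps_expansion_unique_complex by blast
  then show ?thesis by (simp add: taylor_coeff_def)
qed

theorem theorem9:
  fixes \<phi> :: "complex \<Rightarrow> complex"
    and B1 B2 B3 \<sigma>4 \<mu>4 :: real
  assumes "ma_minda \<phi>"
    and "B1 = real_coeff \<phi> 1" and "B2 = real_coeff \<phi> 2" and "B3 = real_coeff \<phi> 3"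
    and "\<sigma>4 = (4 * B2 - 7 * B1\<^sup>2) / (2 * B1)"
    and "\<mu>4 = (6 * B1 ^ 3 - 7 * B1 * B2 + 2 * B3) / (2 * B1)"
    and "(\<sigma>4, \<mu>4) \<in> Omega1 \<union> Omega2 \<union> Omega3"
    and "B1 \<le> \<bar>2 * B1\<^sup>2 - B2\<bar>"
  shows "(\<forall>f \<in> class_C \<phi>.
            norm ((inverse_coeff f 3)\<^sup>2 - (inverse_coeff f 4)\<^sup>2)
              \<le> (B2 - 2 * B1\<^sup>2)\<^sup>2 / 36 + (6 * B1 ^ 3 - 7 * B1 * B2 + 2 * B3)\<^sup>2 / 576) \<and>
         (\<exists>f \<in> class_C \<phi>.
            norm ((inverse_coeff f 3)\<^sup>2 - (inverse_coeff f 4)\<^sup>2)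
              = (B2 - 2 * B1\<^sup>2)\<^sup>2 / 36 + (6 * B1 ^ 3 - 7 * B1 * B2 + 2 * B3)\<^sup>2 / 576)"
proof -
  let ?T3 = "(B2 - 2 * B1\<^sup>2)\<^sup>2 / 36" and ?T4 = "(6 * B1 ^ 3 - 7 * B1 * B2 + 2 * B3)\<^sup>2 / 576"
  have hol: "\<phi> holomorphic_on unit_disc" "\<phi> 0 = 1" using assms(1) by (auto simp: ma_minda_def)
  have "0 < B1"
    using ma_minda_real_coeff_1_pos[OF assms(1)] assms(2) by simp
  have \<mu>2: "(B1 / 12 * \<mu>4)\<^sup>2 = ?T4"
    using \<open>0 < B1\<close> unfolding assms(6) by (simp add: power_divide)
  have "norm ((inverse_coeff f 3)\<^sup>2 - (inverse_coeff f 4)\<^sup>2) \<le> ?T3 + ?T4" if f: "f \<in> class_C \<phi>" for f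
  proof -
    obtain \<omega> where \<omega>: "\<omega> holomorphic_on unit_disc" "\<omega> 0 = 0" "\<And>z. norm z < 1 \<Longrightarrow> norm (\<omega> z) \<le> 1"
      "\<forall>z\<in>unit_disc. 1 + z * deriv (deriv f) z / deriv f z = \<phi> (\<omega> z)"
      using f unfolding class_C_def subordinate_def by auto
    have fA: "f \<in> class_A" "\<forall>z\<in>unit_disc. deriv f z \<noteq> 0"
      using f by (auto simp: class_C_def)
    note b = class_C_inverse_coeffs[OF assms(1) fA \<omega>(1,2,4) assms(2-6)]
    define c where "c = taylor_coeff \<omega>"
    have c: "schur_triple (c 1) (c 2) (c 3)"
      unfolding c_def by (rule schwarz_function_schur_triple[OF \<omega>(1-3)])
    have c1: "(norm (c 1))\<^sup>2 \<le> 1" using c by (simp add: schur_triple_def abs_square_le_1)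
    have "norm (of_real B1 * c 2 + of_real (B2 - 2 * B1\<^sup>2) * (c 1)\<^sup>2)
        \<le> B1 * (1 - (norm (c 1))\<^sup>2) + \<bar>2 * B1\<^sup>2 - B2\<bar> * (norm (c 1))\<^sup>2"
      using \<open>0 < B1\<close> schur_triple_norm_c2_le[OF c]
      by (intro norm_triangle_mono) (auto simp: norm_mult norm_power abs_minus_commute
          simp flip: of_real_diff of_real_mult of_real_power)
    also have "\<dots> \<le> \<bar>2 * B1\<^sup>2 - B2\<bar> * (1 - (norm (c 1))\<^sup>2) + \<bar>2 * B1\<^sup>2 - B2\<bar> * (norm (c 1))\<^sup>2"
      using c1 assms(8) by (intro add_right_mono mult_right_mono) auto
    also have "\<dots> = \<bar>B2 - 2 * B1\<^sup>2\<bar>" by (simp add: algebra_simps)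
    finally have "norm (inverse_coeff f 3) \<le> \<bar>B2 - 2 * B1\<^sup>2\<bar> / 6"
      unfolding b(1) c_def[symmetric] norm_divide norm_minus_cancel by simp
    then have 3: "(norm (inverse_coeff f 3))\<^sup>2 \<le> ?T3"
      using power_mono[of _ _ 2] by (fastforce simp: power_divide)
    have "norm (inverse_coeff f 4) \<le> B1 / 12 * \<mu>4"
      using prokhorov_szynal[OF c assms(7)] \<open>0 < B1\<close>
      unfolding b(2) c_def[symmetric] norm_mult norm_divide norm_minus_cancel by simp
    then have 4: "(norm (inverse_coeff f 4))\<^sup>2 \<le> ?T4"
      unfolding \<mu>2[symmetric] by (intro power_mono) auto
    have "norm ((inverse_coeff f 3)\<^sup>2 - (inverse_coeff f 4)\<^sup>2) \<le> (norm (inverse_coeff f 3))\<^sup>2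
        + (norm (inverse_coeff f 4))\<^sup>2"
      using norm_triangle_ineq4 by (metis norm_power)
    with 3 4 show ?thesis by linarith
  qed
  moreover have "\<exists>f \<in> class_C \<phi>. norm ((inverse_coeff f 3)\<^sup>2 - (inverse_coeff f 4)\<^sup>2) = ?T3 + ?T4"
  proof -
    define \<omega> where "\<omega> = (\<lambda>z. \<i> * z)"
    have \<omega>: "\<omega> holomorphic_on unit_disc" "\<omega> 0 = 0" "\<And>z. norm z < 1 \<Longrightarrow> norm (\<omega> z) < 1"
      by (auto simp: \<omega>_def norm_mult intro!: holomorphic_intros)
    have "(\<phi> \<circ> \<omega>) holomorphic_on unit_disc"
      by (rule holomorphic_on_compose_gen[OF \<omega>(1) hol(1)]) (use \<omega>(3) in auto)
    moreover have "(\<phi> \<circ> \<omega>) 0 = 1" using hol(2) \<omega>(2) by simp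
    ultimately obtain f where f: "f \<in> class_A" "\<forall>z\<in>unit_disc. deriv f z \<noteq> 0"
      "\<forall>z\<in>unit_disc. 1 + z * deriv (deriv f) z / deriv f z = (\<phi> \<circ> \<omega>) z"
      by (rule ex_convex_subordination)
    have fC: "f \<in> class_C \<phi>"
      unfolding class_C_def subordinate_def using f \<omega> by (auto intro!: exI[of _ \<omega>] less_imp_le)
    have eq: "\<forall>z\<in>unit_disc. 1 + z * deriv (deriv f) z / deriv f z = \<phi> (\<omega> z)"
      using f(3) by simp
    note b = class_C_inverse_coeffs[OF assms(1) f(1,2) \<omega>(1,2) eq assms(2-6)]
    have c: "taylor_coeff \<omega> 1 = \<i>" "taylor_coeff \<omega> 2 = 0" "taylor_coeff \<omega> 3 = 0"
      unfolding \<omega>_def taylor_coeff_mult_ident by auto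
    have "(inverse_coeff f 3)\<^sup>2 = of_real ?T3"
      unfolding b(1) c by (simp add: power_divide)
    moreover have "(inverse_coeff f 4)\<^sup>2 = - of_real ((B1 / 12 * \<mu>4)\<^sup>2)"
      unfolding b(2) c by (simp add: power_divide power_mult_distrib flip: power_mult)
    ultimately have "(inverse_coeff f 3)\<^sup>2 - (inverse_coeff f 4)\<^sup>2 = of_real (?T3 + ?T4)"
      unfolding \<mu>2 by simp
    then have "norm ((inverse_coeff f 3)\<^sup>2 - (inverse_coeff f 4)\<^sup>2) = ?T3 + ?T4"
      by (simp only: norm_of_real) simp
    with fC show ?thesis by blast
  qed
  ultimately show ?thesis by blast
qed

end
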